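(* For any integer $r\ge 1$ and any complex $s$ with $\operatorname{Re}(s)>1$, $$\sum_{n=1}^{\infty}\frac{\overline{c}_r(n)}{n^s}=(\phi_{1-s}\oplus 1)(r)\,\zeta(s).$$
   Context: $\zeta$ is the Riemann zeta function and $\mu$ the Möbius function. An integer $a$ is regular (mod $r$) if there is an integer $x$ with $a^2x\equiv a \pmod r$. Define $$\overline{c}_r(n)=\sum_{\substack{a \pmod r\\ a\text{ regular}\pmod r}}\exp(2\pi i a n/r),$$ the sum being over the regular elements $a$ of a complete residue system mod $r$ (e.g. $1\le a\le r$). For complex $t$, $\phi_t(r)=\sum_{d\mid r}d^t\mu(r/d)$. A positive divisor $d$ of $r$ is a unitary divisor, written $d\,\|\,r$, if $\gcd(d,r/d)=1$; the unitary convolution is $(f\oplus g)(r)=\sum_{d\,\|\,r}f(d)g(r/d)$, and $1$ denotes the constant function $1$. *)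

theory Defs
  imports
    "HOL-Analysis.Analysis"
    "HOL-Number_Theory.Number_Theory"
    "HOL-Computational_Algebra.Computational_Algebra"
begin

definition regular_mod :: "int \<Rightarrow> int \<Rightarrow> bool" where
  "regular_mod r a \<longleftrightarrow> (\<exists>x::int. [a\<^sup>2 * x = a] (mod r))"

definition reg_ramanujan_sum :: "nat \<Rightarrow> int \<Rightarrow> complex" where
  "reg_ramanujan_sum r n =
     (\<Sum>a | a \<in> {1..int r} \<and> regular_mod (int r) a.
        exp (2 * of_real pi * \<i> * of_int a * of_int n / of_nat r))"

definition moebius :: "nat \<Rightarrow> complex" where
  "moebius n = (if squarefree n then (- 1) ^ card (prime_factors n) else 0)"

definition phi_gen :: "complex \<Rightarrow> nat \<Rightarrow> complex" where
  "phi_gen t r = (\<Sum>d | d dvd r. of_nat d powr t * moebius (r div d))"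

definition unitary_dvd :: "nat \<Rightarrow> nat \<Rightarrow> bool" where
  "unitary_dvd d r \<longleftrightarrow> d dvd r \<and> coprime d (r div d)"

definition unitary_conv :: "(nat \<Rightarrow> complex) \<Rightarrow> (nat \<Rightarrow> complex) \<Rightarrow> nat \<Rightarrow> complex" where
  "unitary_conv f g r = (\<Sum>d | unitary_dvd d r. f d * g (r div d))"

text \<open>
  The Riemann zeta function on the half-plane \<open>Re s > 1\<close>, where it is given by its
  Dirichlet series. The analytic continuation is not modelled: values for \<open>Re s \<le> 1\<close>
  are meaningless.
\<close>
definition riemann_zeta :: "complex \<Rightarrow> complex" where
  "riemann_zeta s = (\<Sum>n. 1 / of_nat (Suc n) powr s)"

end

(* Write g = gcd(a, r) and a = g b, r = g d. Since b is a unit mod d, the congruence a^2 x = a (mod r)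
   amounts to g b x = 1 (mod d), so a is regular iff g is coprime to d = r/g. Grouping the regular
   residues by g turns the sum into the sum of the ordinary Ramanujan sums c_d(n) over the unitary
   divisors d of r. Since c_d(n) is the sum of e mu(d/e) over the common divisors e of d and n, and
   the multiples of e contribute e^(-s) zeta(s), the Dirichlet series of c_d is phi_(1-s)(d) zeta(s). *)
theory Submission
  imports Defs
begin

text \<open>The terms are the powers of a single number \<open>z\<close> with
  \<open>z ^ m = 1\<close>. Their geometric sum vanishes unless \<open>z = 1\<close>, which happens
  exactly when \<open>m\<close> divides \<open>n\<close>.\<close>

lemma complete_exponential_sum:
  fixes m n :: nat
  assumes "m > 0"
  shows "(\<Sum>j\<in>{1..m}. exp (2 * of_real pi * \<i> * of_nat j * of_nat n / of_nat m)) =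
           (if m dvd n then of_nat m else (0::complex))"
proof -
  define z where "z = exp (2 * of_real pi * \<i> * of_nat n / of_nat m :: complex)"
  have zj: "exp (2 * of_real pi * \<i> * of_nat j * of_nat n / of_nat m) = z ^ j" for j
    unfolding z_def exp_of_nat_mult [symmetric] by (simp add: mult_ac)
  have zm: "z ^ m = 1"
    using assms exp_of_nat_mult [of m "2 * of_real pi * \<i> * of_nat n / of_nat m"]
      exp_integer_2pi [of "of_nat n"]
    by (simp add: z_def mult_ac)
  have z1: "z = 1 \<longleftrightarrow> m dvd n"
  proof
    assume "z = 1"
    then obtain k :: int where "2 * pi * n / m = of_int (2 * k) * pi"
      unfolding z_def exp_eq_1 by auto
    hence "real n = of_int (k * int m)"
      using assms by (simp add: field_simps)
    hence "int n = k * int m"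
      by (metis of_int_eq_iff of_int_of_nat_eq)
    thus "m dvd n"
      by (metis dvd_triv_right int_dvd_int_iff)
  next
    assume "m dvd n"
    then obtain k where "n = m * k" ..
    thus "z = 1"
      using assms exp_integer_2pi [of "of_nat k"] by (simp add: z_def mult_ac)
  qed
  \<comment> \<open>The range starts at 1, so one factor \<open>z\<close> is split off to reach the
    geometric sum that starts at exponent 0.\<close>
  have "(\<Sum>j\<in>{1..m}. z ^ j) = z * (\<Sum>j<m. z ^ j)"
    by (simp add: sum_distrib_left sum.atLeast1_atMost_eq)
  also have "\<dots> = (if m dvd n then of_nat m else 0)"
    using z1 zm by (auto simp: sum_gp_strict)
  finally show ?thesis
    by (simp only: zj)
qed

text \<open>Squarefree divisors correspond to sets of prime factors of \<open>n\<close>. Counting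
  these sets with sign expands \<open>(1 - 1) ^ k\<close>, where \<open>k\<close> is the number of
  distinct prime factors, and this is 0 unless \<open>k = 0\<close>.\<close>

lemma sum_moebius_divisors:
  assumes "n > 0"
  shows "(\<Sum>d | d dvd n. moebius d) = (if n = 1 then 1 else 0)"
proof -
  let ?P = "prime_factors n"
  have prod_pf: "prime_factors (\<Prod>S) = S" "squarefree (\<Prod>S)" if "S \<subseteq> ?P" for S
  proof -
    have fin: "finite S" and pr: "\<And>p. p \<in> S \<Longrightarrow> prime p"
      using that finite_subset[OF that] by auto
    have nz: "0 \<notin> S" using pr not_prime_0 by blast
    have "prime_factors (\<Prod>S) = \<Union>(prime_factors ` S)"
      using prime_factors_prod[OF fin, of id] nz by simp
    also have "\<dots> = S"
      using pr by (auto simp: prime_factorization_prime)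
    finally show "prime_factors (\<Prod>S) = S" .
    show "squarefree (\<Prod>S)"
      using pr by (intro squarefree_prod_coprime) (auto intro: primes_coprime squarefree_prime)
  qed
  have "(\<Sum>d | d dvd n. moebius d) = (\<Sum>d | d dvd n \<and> squarefree d. (-1) ^ card (prime_factors d))"
    using assms by (intro sum.mono_neutral_cong_right) (auto simp: moebius_def)
  also have "\<dots> = (\<Sum>S\<in>Pow ?P. (-1) ^ card S)"
  proof (rule sum.reindex_bij_witness[of _ "\<lambda>S. \<Prod>S" prime_factors])
    fix d assume "d \<in> {d. d dvd n \<and> squarefree d}"
    hence d: "d dvd n" "squarefree d" "d \<noteq> 0"
      using assms by auto
    \<comment> \<open>In a squarefree \<open>d\<close> every prime factor has multiplicity 1, so
      \<open>d\<close> is recovered from its set of prime factors.\<close>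
    have "\<Prod>(prime_factors d) = (\<Prod>p\<in>prime_factors d. p ^ multiplicity p d)"
    proof (intro prod.cong refl)
      fix p assume "p \<in> prime_factors d"
      hence "multiplicity p d = 1"
        using d squarefree_factorial_semiring''[of d]
        by (auto simp: prime_factors_multiplicity intro: le_antisym)
      thus "p = p ^ multiplicity p d" by simp
    qed
    also have "\<dots> = d"
      using d(3) by (simp add: prime_factorization_nat [symmetric])
    finally show "\<Prod>(prime_factors d) = d" .
    show "prime_factors d \<in> Pow ?P"
      using d(1) assms dvd_prime_factors by blast
  next
    fix S assume "S \<in> Pow ?P"
    \<comment> \<open>A product of distinct prime factors of \<open>n\<close> divides the product of
      all of them, which divides \<open>n\<close>.\<close>
    hence "\<Prod>S dvd \<Prod>?P"
      by (intro prod_dvd_prod_subset) auto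
    also have "\<dots> dvd (\<Prod>p\<in>?P. p ^ multiplicity p n)"
      by (intro prod_dvd_prod dvd_power) (auto simp: prime_factors_multiplicity)
    also have "\<dots> = n"
      using assms by (simp add: prime_factorization_nat [symmetric])
    finally show "\<Prod>S \<in> {d. d dvd n \<and> squarefree d}"
      using prod_pf \<open>S \<in> Pow ?P\<close> by simp
  qed (use prod_pf in auto)
  also have "\<dots> = (\<Prod>p\<in>?P. -1 + 1)"
    by (subst prod_add) simp_all
  also have "\<dots> = (if n = 1 then 1 else 0)"
    using assms by (auto simp: prime_factorization_empty_iff card_gt_0_iff)
  finally show ?thesis .
qed

lemma regular_mod_iff_coprime:
  assumes "r > 0"
  shows "regular_mod r a \<longleftrightarrow> coprime (gcd a r) (r div gcd a r)"
proof -
  define g where "g = gcd a r"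
  have g0: "g \<noteq> 0" using assms by (simp add: g_def)
  then obtain b d where bd: "a = b * g" "r = d * g" "coprime b d"
    unfolding g_def by (meson gcd_coprime_exists)
  have g: "g = gcd a r" "a = g * b" "r = g * d" "coprime b d"
    by (rule g_def, subst mult.commute, rule bd, subst mult.commute, rule bd, rule bd)
  have "regular_mod r a \<longleftrightarrow> (\<exists>x. d dvd (g * b * x - 1) * b)"
  proof -
    have "r dvd a\<^sup>2 * x - a \<longleftrightarrow> d dvd (g * b * x - 1) * b" for x
    proof -
      have "a\<^sup>2 * x - a = g * ((g * b * x - 1) * b)"
        by (simp add: g(2) power2_eq_square algebra_simps)
      thus ?thesis using g0 by (simp add: g(3))
    qed
    thus ?thesis by (simp add: regular_mod_def cong_iff_dvd_diff)
  qed
  \<comment> \<open>The factor \<open>b\<close> is coprime to \<open>d\<close> and cancels. What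
    remains is the invertibility of \<open>g * b\<close> modulo \<open>d\<close>.\<close>
  also have "\<dots> \<longleftrightarrow> (\<exists>x. [(g * b) * x = 1] (mod d))"
    using g(4) by (simp add: cong_iff_dvd_diff coprime_dvd_mult_left_iff coprime_commute)
  also have "\<dots> \<longleftrightarrow> coprime (g * b) d"
    by (simp add: coprime_iff_invertible_int)
  also have "\<dots> \<longleftrightarrow> coprime g d"
    using g(4) by simp
  also have "d = r div gcd a r"
    using g0 g(3) unfolding g(1) [symmetric] by simp
  finally show ?thesis unfolding g(1) [symmetric] .
qed

text \<open>Only the multiples \<open>d * k\<close> contribute, and the power of \<open>d\<close>
  factors out of each term. This evaluates the divisibility conditions left over once the Ramanujan
  sums are written through divisors.\<close>

lemma zeta_multiples_sums:
  assumes "d > 0" "Re s > 1"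
  shows "(\<lambda>n. if d dvd Suc n then 1 / of_nat (Suc n) powr s else 0) sums
           (of_nat d powr (- s) * riemann_zeta s)"
proof -
  let ?f = "\<lambda>n. if d dvd Suc n then 1 / of_nat (Suc n) powr s else (0::complex)"
  \<comment> \<open>Index \<open>n\<close> carries the integer \<open>Suc n\<close>, so the multiple
    \<open>d * Suc n\<close> sits one place lower.\<close>
  let ?g = "\<lambda>n. d * Suc n - 1"
  have "summable (\<lambda>n. exp (of_real (ln (of_nat n)) * (- s)))"
    using assms by (intro summable_complex_powr_iff) simp
  \<comment> \<open>The shift drops the term at 0, where the logarithm has only a default
    value.\<close>
  hence "summable (\<lambda>n. exp (of_real (ln (of_nat (Suc n))) * (- s)))"
    by (subst summable_Suc_iff)
  also have "(\<lambda>n. exp (of_real (ln (of_nat (Suc n))) * (- s))) = (\<lambda>n. 1 / of_nat (Suc n) powr s)"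
    by (simp add: powr_def exp_minus field_simps Ln_of_nat del: of_nat_Suc)
  finally have "(\<lambda>n. 1 / of_nat (Suc n) powr s) sums riemann_zeta s"
    unfolding riemann_zeta_def by (rule summable_sums)
  hence "(\<lambda>n. of_nat d powr (- s) * (1 / of_nat (Suc n) powr s)) sums
           (of_nat d powr (- s) * riemann_zeta s)"
    by (rule sums_mult)
  also have "(\<lambda>n. of_nat d powr (- s) * (1 / of_nat (Suc n) powr s)) = (\<lambda>n. ?f (?g n))"
  proof
    fix n
    have "Suc (?g n) = d * Suc n" using assms by simp
    \<comment> \<open>Complex powers are not multiplicative in the base in general; here both bases
      are nonnegative reals.\<close>
    moreover have "(of_nat (d * Suc n) :: complex) powr s = of_nat d powr s * of_nat (Suc n) powr s"
      unfolding of_nat_mult by (rule powr_times_real) (auto simp del: of_nat_Suc)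
    ultimately show "of_nat d powr (- s) * (1 / of_nat (Suc n) powr s) = ?f (?g n)"
      by (simp add: powr_minus field_simps del: of_nat_Suc mult_Suc_right)
  qed
  also have "(\<lambda>n. ?f (?g n)) sums (of_nat d powr (- s) * riemann_zeta s) \<longleftrightarrow>
               ?f sums (of_nat d powr (- s) * riemann_zeta s)"
  proof (rule sums_mono_reindex)
    show "strict_mono ?g"
      using assms by (auto simp: strict_mono_Suc_iff)
    fix n assume n: "n \<notin> range ?g"
    have "\<not> d dvd Suc n"
    proof
      assume "d dvd Suc n"
      then obtain k where "Suc n = d * k" ..
      hence "n = ?g (k - 1)" by (cases k) auto
      with n show False by blast
    qed
    thus "?f n = 0" by simp
  qed
  finally show ?thesis .
qed

text \<open>
  Detecting coprimality by \<open>sum_moebius_divisors\<close> leaves complete exponential sums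
  modulo the divisors of \<open>d\<close>.
\<close>
lemma ramanujan_sum_eq:
  fixes d n :: nat
  assumes "d > 0"
  shows "(\<Sum>b | b \<in> {1..d} \<and> coprime b d. exp (2 * of_real pi * \<i> * of_nat b * of_nat n / of_nat d)) =
           (\<Sum>e | e dvd d. if e dvd n then of_nat e * moebius (d div e) else 0)"
proof -
  let ?E = "\<lambda>d b. exp (2 * of_real pi * \<i> * of_nat b * of_nat n / of_nat d) :: complex"
  have "(\<Sum>b | b \<in> {1..d} \<and> coprime b d. ?E d b) =
          (\<Sum>b\<in>{1..d}. \<Sum>k | k dvd gcd b d. moebius k * ?E d b)"
  proof (intro sum.mono_neutral_cong_left ballI)
    fix b
    have "gcd b d > 0" using assms by simp
    hence E: "(\<Sum>k | k dvd gcd b d. moebius k * ?E d b) = (if coprime b d then 1 else 0) * ?E d b"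
      unfolding sum_distrib_right [symmetric] coprime_iff_gcd_eq_1 by (subst sum_moebius_divisors, assumption) (rule refl)
    show "(\<Sum>k | k dvd gcd b d. moebius k * ?E d b) = 0"
      if "b \<in> {1..d} - {b. b \<in> {1..d} \<and> coprime b d}"
      unfolding E using that by auto
    show "?E d b = (\<Sum>k | k dvd gcd b d. moebius k * ?E d b)"
      if "b \<in> {b. b \<in> {1..d} \<and> coprime b d}"
      unfolding E using that by auto
  qed auto
  also have "\<dots> = (\<Sum>b\<in>{1..d}. \<Sum>k | k \<in> {k. k dvd d} \<and> k dvd b. moebius k * ?E d b)"
    by (intro sum.cong) auto
  also have "\<dots> = (\<Sum>k | k dvd d. \<Sum>b | b \<in> {1..d} \<and> k dvd b. moebius k * ?E d b)"
    using assms by (intro sum.swap_restrict) auto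
  also have "\<dots> = (\<Sum>k | k dvd d. moebius k * (\<Sum>j\<in>{1..d div k}. ?E (d div k) j))"
  proof (intro sum.cong refl)
    fix k assume "k \<in> {k. k dvd d}"
    then obtain m where d: "d = k * m" by auto
    hence "k > 0" "m > 0" using assms by auto
    \<comment> \<open>Writing \<open>b = k * j\<close> cancels \<open>k\<close> against
      \<open>d = k * m\<close> and leaves a complete sum modulo \<open>m\<close>.\<close>
    have "(\<Sum>b | b \<in> {1..d} \<and> k dvd b. ?E d b) = (\<Sum>j\<in>{1..m}. ?E m j)"
      by (rule sum.reindex_bij_witness[of _ "\<lambda>j. k * j" "\<lambda>b. b div k"])
         (use \<open>k > 0\<close> \<open>m > 0\<close> in \<open>auto simp: d field_simps Suc_le_eq\<close>)
    thus "(\<Sum>b | b \<in> {1..d} \<and> k dvd b. moebius k * ?E d b) =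
            moebius k * (\<Sum>j\<in>{1..d div k}. ?E (d div k) j)"
      using \<open>k > 0\<close> by (simp add: d flip: sum_distrib_left)
  qed
  \<comment> \<open>Each divisor \<open>k\<close> is replaced by its complementary divisor
    \<open>e = d div k\<close>.\<close>
  also have "\<dots> = (\<Sum>e | e dvd d. moebius (d div e) * (\<Sum>j\<in>{1..e}. ?E e j))"
    using assms
    by (intro sum.reindex_bij_witness[of _ "\<lambda>e. d div e" "\<lambda>e. d div e"]) auto
  also have "\<dots> = (\<Sum>e | e dvd d. if e dvd n then of_nat e * moebius (d div e) else 0)"
  proof (intro sum.cong refl)
    fix e assume "e \<in> {e. e dvd d}"
    hence "e > 0" using assms dvd_pos_nat by blast
    thus "moebius (d div e) * (\<Sum>j\<in>{1..e}. ?E e j) =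
            (if e dvd n then of_nat e * moebius (d div e) else 0)"
      by (subst complete_exponential_sum) auto
  qed
  finally show ?thesis .
qed

text \<open>The exponential depends on \<open>a\<close> only through the fraction
  \<open>a / r\<close>. In lowest terms this is \<open>b / d\<close>, and \<open>a\<close> is
  regular exactly when \<open>d\<close> is a unitary divisor of \<open>r\<close>. Each such
  \<open>d\<close> thus contributes its ordinary Ramanujan sum.\<close>

lemma reg_ramanujan_sum_eq:
  fixes r n :: nat
  assumes "r > 0"
  shows "reg_ramanujan_sum r (int n) =
           (\<Sum>d | unitary_dvd d r. \<Sum>e | e dvd d. if e dvd n then of_nat e * moebius (d div e) else 0)"
proof -
  let ?E = "\<lambda>d b. exp (2 * of_real pi * \<i> * of_nat b * of_nat n / of_nat d) :: complex"
  let ?C = "\<lambda>d. {b. b \<in> {1..d} \<and> coprime b d}"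
  have pos: "d > 0" if "unitary_dvd d r" for d
    using that assms by (metis dvd_pos_nat unitary_dvd_def)
  have fin: "finite {d. unitary_dvd d r}"
    using assms by (intro finite_subset[OF _ finite_divisors_nat[of r]]) (auto simp: unitary_dvd_def)
  \<comment> \<open>This fact and \<open>reg_cases\<close> unpack the two index sets into the same
    data, with \<open>q\<close> in the role of \<open>g\<close>, so that the bijection below can be
    checked mostly by simplification.\<close>
  have unitary_cases: "\<exists>d b q. x = (d, b) \<and> r = q * d \<and> coprime q d \<and> coprime b d \<and>
      1 \<le> b \<and> b \<le> d \<and> d > 0 \<and> q > 0 \<and> gcd (int (q * b)) (int r) = int q"
    if "x \<in> (SIGMA d:{d. unitary_dvd d r}. ?C d)" for x
  proof -
    from that obtain d b where x: "x = (d, b)" "unitary_dvd d r" "b \<in> ?C d"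
      by auto
    then obtain q where q: "r = q * d" "coprime d q"
      using assms by (auto simp: unitary_dvd_def)
    have "gcd (q * b) (q * d) = q"
      using x(3) by (simp add: gcd_mult_distrib_nat [symmetric])
    hence "gcd (int (q * b)) (int r) = int q"
      unfolding q(1) gcd_int_int_eq by simp
    with x q assms show ?thesis by (auto simp: coprime_commute)
  qed
  have reg_cases: "\<exists>g b d. a = int (g * b) \<and> r = g * d \<and> gcd a (int r) = int g \<and> g > 0 \<and> d > 0 \<and>
      coprime b d \<and> coprime g d \<and> 1 \<le> b \<and> b \<le> d"
    if "a \<in> {a. a \<in> {1..int r} \<and> regular_mod (int r) a}" for a
  proof -
    define m where "m = nat a"
    define g where "g = gcd m r"
    have a: "a = int m" "1 \<le> m" "m \<le> r"
      using that by (auto simp: m_def)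
    have "g > 0" using assms by (simp add: g_def)
    then obtain b d where bd: "m = b * g" "r = d * g" "coprime b d"
      unfolding g_def by (metis gcd_coprime_exists less_irrefl)
    have gcd: "gcd a (int r) = int g"
      by (simp add: a g_def)
    have "coprime (int g) (int r div int g)"
      using that assms gcd by (simp add: regular_mod_iff_coprime)
    hence "coprime g d"
      using bd(2) \<open>g > 0\<close> by simp
    moreover have "1 \<le> b" "b \<le> d" "d > 0"
      using a bd \<open>g > 0\<close> assms by (auto simp: Suc_le_eq)
    ultimately show ?thesis
      using a bd gcd \<open>g > 0\<close> by (intro exI[of _ g] exI[of _ b] exI[of _ d]) (simp add: mult.commute)
  qed
  have "(\<Sum>d | unitary_dvd d r. \<Sum>e | e dvd d. if e dvd n then of_nat e * moebius (d div e) else 0) =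
          (\<Sum>d | unitary_dvd d r. \<Sum>b\<in>?C d. ?E d b)"
    using pos by (intro sum.cong refl ramanujan_sum_eq [symmetric]) auto
  also have "\<dots> = (\<Sum>(d, b)\<in>(SIGMA d:{d. unitary_dvd d r}. ?C d). ?E d b)"
    using fin by (intro sum.Sigma) auto
  also have "\<dots> = reg_ramanujan_sum r (int n)"
    unfolding reg_ramanujan_sum_def
  \<comment> \<open>A residue is sent to the denominator and numerator of its reduced fraction; the
    inverse clears the denominator. The zero class is represented by \<open>r\<close> and goes to
    \<open>(1, 1)\<close>, so the ranges starting at 1 match.\<close>
  proof (rule sum.reindex_bij_witness[symmetric, of _
      "\<lambda>(d, b). int ((r div d) * b)"
      "\<lambda>a. (nat (int r div gcd a (int r)), nat (a div gcd a (int r)))"], goal_cases)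
    case (1 a)
    then obtain g b d where "a = int (g * b)" "r = g * d" "gcd a (int r) = int g" "g > 0" "d > 0"
      using reg_cases by blast
    then show ?case by simp
  next
    case (2 a)
    then obtain g b d where "a = int (g * b)" "r = g * d" "gcd a (int r) = int g" "g > 0"
      "d > 0" "coprime b d" "coprime g d" "1 \<le> b" "b \<le> d"
      using reg_cases by blast
    then show ?case
      by (simp add: unitary_dvd_def coprime_commute)
  next
    case (3 x)
    then obtain d b q where x: "x = (d, b)" "r = q * d" "coprime b d" "d > 0" "q > 0"
      "gcd (int (q * b)) (int r) = int q"
      using unitary_cases by blast
    have "nat (int q * int b div int q) = b"
      using x(5) by simp
    with x show ?case by simp
  next
    case (4 x)
    then obtain d b q where x: "x = (d, b)" "r = q * d" "coprime q d" "1 \<le> b" "b \<le> d" "d > 0" "q > 0"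
      "gcd (int (q * b)) (int r) = int q"
      using unitary_cases by blast
    have "regular_mod (int r) (int (q * b))"
      using x assms by (subst regular_mod_iff_coprime) simp_all
    with x show ?case by (simp add: Suc_le_eq flip: of_nat_mult)
  next
    case (5 a)
    then obtain g b d where "a = int (g * b)" "r = g * d" "gcd a (int r) = int g" "g > 0" "d > 0"
      using reg_cases by blast
    then show ?case by (simp add: mult.assoc)
  qed
  finally show ?thesis ..
qed

theorem theorem7p1:
  fixes r :: nat and s :: complex
  assumes "r \<ge> 1" and "Re s > 1"
  shows "(\<lambda>n. reg_ramanujan_sum r (int (Suc n)) / of_nat (Suc n) powr s) sums
           (unitary_conv (phi_gen (1 - s)) (\<lambda>_. 1) r * riemann_zeta s)"
proof -
  have pos: "e > 0" if "unitary_dvd d r" "e dvd d" for d e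
    using that assms(1) dvd_pos_nat[of r e] by (auto simp: unitary_dvd_def intro: dvd_trans)
  \<comment> \<open>The sums over \<open>d\<close> and \<open>e\<close> are finite, so the series
    can be evaluated separately for each pair.\<close>
  have "(\<lambda>n. \<Sum>d | unitary_dvd d r. \<Sum>e | e dvd d. of_nat e * moebius (d div e) *
            (if e dvd Suc n then 1 / of_nat (Suc n) powr s else 0)) sums
          (\<Sum>d | unitary_dvd d r. \<Sum>e | e dvd d. of_nat e * moebius (d div e) *
            (of_nat e powr (- s) * riemann_zeta s))"
    using assms(2) pos by (intro sums_sum sums_mult zeta_multiples_sums) auto
  also have "(\<lambda>n. \<Sum>d | unitary_dvd d r. \<Sum>e | e dvd d. of_nat e * moebius (d div e) *
            (if e dvd Suc n then 1 / of_nat (Suc n) powr s else 0)) =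
          (\<lambda>n. reg_ramanujan_sum r (int (Suc n)) / of_nat (Suc n) powr s)"
    using assms
    by (subst reg_ramanujan_sum_eq)
       (auto simp: sum_divide_distrib fun_eq_iff simp del: of_nat_Suc intro!: sum.cong)
  \<comment> \<open>The weight \<open>e\<close> combines with \<open>e powr (- s)\<close> to
    \<open>e powr (1 - s)\<close>, which is where the parameter of \<open>phi_gen\<close> comes
    from.\<close>
  also have "(\<Sum>d | unitary_dvd d r. \<Sum>e | e dvd d. of_nat e * moebius (d div e) *
            (of_nat e powr (- s) * riemann_zeta s)) =
          unitary_conv (phi_gen (1 - s)) (\<lambda>_. 1) r * riemann_zeta s"
    unfolding unitary_conv_def phi_gen_def sum_distrib_right
    by (intro sum.cong) (auto simp: powr_diff powr_minus field_simps)
  finally show ?thesis .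
qed

end
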